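(* Let $M=(E,r)$ be a matroid of rank three with distinguished basis $B$, and let $g:\mathcal P(E)\to\mathbb R_{\ge0}$ be a polymatroid extending $M$. Suppose $\mathcal U=\{U_e\}_{e\in E}$ is a subspace arrangement over a field with $\dim U_T=c\cdot g(T)$ for all $T\subseteq E$. Put $A_e=U_e\cap U_B$ for $e\in E$. Then $\mathcal A=\{A_e\}_{e\in E}$ is a weak $c$-representation of $M$ with respect to $B$.
   Context: $U_T=\sum_{e\in T}U_e$. A polymatroid is a monotone submodular $g:\mathcal P(E)\to\mathbb R_{\ge0}$. A polymatroid $g$ extends $M$ (w.r.t. $B$) if $g(C)+g(S)-g(S\cup C)=r(C)+r(S)-r(S\cup C)$ for all $C\subseteq B$ and $S\subseteq E$. For an arrangement $\mathcal A$ put $A_X=\sum_{e\in X}A_e$ and $r^c_{\mathcal A}(X)=\frac1c\dim A_X$; $\mathcal A$ is a weak $c$-representation of $M$ w.r.t. $B$ if $\dim A_e=c$ for all $e$, $r^c_{\mathcal A}(X)\le r(X)$ for all $X\subseteq E$, and $r^c_{\mathcal A}(Y)=r(Y)$ whenever $|Y\setminus B|\le1$.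
   Formalization: The matroid M is additionally assumed to have no loops; if e is a loop then dim(U_e ∩ U_B) = 0, so dim A_e = c fails and the claim is false. *)

theory Defs
  imports Complex_Main "HOL-Library.Set_Algebras"
begin

definition matroid :: "'e set \<Rightarrow> ('e set \<Rightarrow> nat) \<Rightarrow> bool" where
  "matroid E r \<longleftrightarrow> finite E
     \<and> (\<forall>X\<subseteq>E. r X \<le> card X)
     \<and> (\<forall>X Y. X \<subseteq> Y \<and> Y \<subseteq> E \<longrightarrow> r X \<le> r Y)
     \<and> (\<forall>X\<subseteq>E. \<forall>Y\<subseteq>E. r (X \<union> Y) + r (X \<inter> Y) \<le> r X + r Y)"

definition indep :: "'e set \<Rightarrow> ('e set \<Rightarrow> nat) \<Rightarrow> 'e set \<Rightarrow> bool" where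
  "indep E r I \<longleftrightarrow> I \<subseteq> E \<and> r I = card I"

definition basis :: "'e set \<Rightarrow> ('e set \<Rightarrow> nat) \<Rightarrow> 'e set \<Rightarrow> bool" where
  "basis E r B \<longleftrightarrow> indep E r B \<and> (\<forall>I. indep E r I \<and> B \<subseteq> I \<longrightarrow> I = B)"

definition loopless :: "'e set \<Rightarrow> ('e set \<Rightarrow> nat) \<Rightarrow> bool" where
  "loopless E r \<longleftrightarrow> (\<forall>e\<in>E. r {e} \<noteq> 0)"

text \<open>Normalisation \<open>g {} = 0\<close> is not part of this notion.\<close>

definition polymatroid :: "'e set \<Rightarrow> ('e set \<Rightarrow> real) \<Rightarrow> bool" where
  "polymatroid E g \<longleftrightarrow> finite E
     \<and> (\<forall>X\<subseteq>E. 0 \<le> g X)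
     \<and> (\<forall>X Y. X \<subseteq> Y \<and> Y \<subseteq> E \<longrightarrow> g X \<le> g Y)
     \<and> (\<forall>X\<subseteq>E. \<forall>Y\<subseteq>E. g (X \<union> Y) + g (X \<inter> Y) \<le> g X + g Y)"

definition extends_matroid ::
  "'e set \<Rightarrow> ('e set \<Rightarrow> nat) \<Rightarrow> 'e set \<Rightarrow> ('e set \<Rightarrow> real) \<Rightarrow> bool" where
  "extends_matroid E r B g \<longleftrightarrow>
     (\<forall>C S. C \<subseteq> B \<and> S \<subseteq> E \<longrightarrow>
        g C + g S - g (S \<union> C) = real (r C) + real (r S) - real (r (S \<union> C)))"

text \<open>
  The ambient space may be infinite-dimensional, but the members of an arrangement are
  finite-dimensional; this is required explicitly because \<^const>\<open>vector_space.dim\<close> is \<open>0\<close> on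
  subspaces of infinite dimension. The sum of subspaces is the elementwise sum of sets.
\<close>

definition subspace_arrangement ::
  "('k::field \<Rightarrow> 'v::ab_group_add \<Rightarrow> 'v) \<Rightarrow> 'e set \<Rightarrow> ('e \<Rightarrow> 'v set) \<Rightarrow> bool" where
  "subspace_arrangement scale E U \<longleftrightarrow>
     (\<forall>e\<in>E. module.subspace scale (U e) \<and> (\<exists>S. finite S \<and> module.span scale S = U e))"

definition arrangement_rank ::
  "('k::field \<Rightarrow> 'v::ab_group_add \<Rightarrow> 'v) \<Rightarrow> nat \<Rightarrow> ('e \<Rightarrow> 'v set) \<Rightarrow> 'e set \<Rightarrow> real" where
  "arrangement_rank scale c A X = (1 / real c) * real (vector_space.dim scale (\<Sum>e\<in>X. A e))"

definition weak_representation ::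
  "('k::field \<Rightarrow> 'v::ab_group_add \<Rightarrow> 'v) \<Rightarrow> nat \<Rightarrow> 'e set \<Rightarrow> ('e set \<Rightarrow> nat) \<Rightarrow> 'e set
     \<Rightarrow> ('e \<Rightarrow> 'v set) \<Rightarrow> bool" where
  "weak_representation scale c E r B A \<longleftrightarrow> subspace_arrangement scale E A
     \<and> (\<forall>e\<in>E. vector_space.dim scale (A e) = c)
     \<and> (\<forall>X\<subseteq>E. arrangement_rank scale c A X \<le> real (r X))
     \<and> (\<forall>Y\<subseteq>E. card (Y - B) \<le> 1 \<longrightarrow> arrangement_rank scale c A Y = real (r Y))"

end

theory Submission
  imports Defs
begin

text \<open>
  Write \<open>U_X\<close> for the sum of the \<open>U_e\<close> with \<open>e \<in> X\<close>. By the modular law \<open>dim (U_C \<inter> U_S)\<close> is the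
  local connectivity of \<open>C\<close> and \<open>S\<close> in \<open>c g\<close>, which for \<open>C \<subseteq> B\<close> is the one in \<open>c r\<close>. Since \<open>B\<close>
  spans \<open>M\<close>, taking \<open>C = B\<close> gives \<open>dim (U_S \<inter> U_B) = c r(S)\<close>, and a second application of the
  modular law gives \<open>dim (U_C + (U_S \<inter> U_B)) = c r(C \<union> S)\<close> for \<open>C \<subseteq> B\<close>. Singletons \<open>S\<close>
  give \<open>dim A_e = c\<close>, and \<open>A_X \<subseteq> U_X \<inter> U_B\<close> gives the rank inequality. If \<open>Y - B\<close> has at most one element, then
  \<open>A_Y = U_C + (U_S \<inter> U_B)\<close> for \<open>C = Y \<inter> B\<close> and \<open>S = Y - B\<close>, hence equality.
\<close>

section \<open>Finite-dimensional subspaces\<close>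

text \<open>
  A copy of the locale \<^locale>\<open>vector_space\<close>: extending \<^locale>\<open>vector_space\<close> itself would
  shadow each new name by its instance for real vector spaces.
\<close>

locale general_vector_space = vector_space
begin

definition fin_dim_subspace :: "'b set \<Rightarrow> bool" where
  "fin_dim_subspace V \<longleftrightarrow> (\<exists>F. finite F \<and> span F = V)"

lemma subspace_if_fin_dim_subspace: "fin_dim_subspace V \<Longrightarrow> subspace V"
  unfolding fin_dim_subspace_def by auto

lemma fin_dim_subspace_span: "finite F \<Longrightarrow> fin_dim_subspace (span F)"
  unfolding fin_dim_subspace_def by blast

lemma finite_if_independent_in_fin_dim_subspace:
  assumes "fin_dim_subspace V" "independent A" "A \<subseteq> V"
  shows "finite A"
  using assms independent_span_bound unfolding fin_dim_subspace_def by metis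

lemma fin_dim_subspace_basis:
  assumes "fin_dim_subspace V"
  obtains A where "finite A" "independent A" "span A = V" "card A = dim V"
proof -
  obtain A where A: "A \<subseteq> V" "independent A" "V \<subseteq> span A" "card A = dim V"
    using basis_exists by metis
  then have "finite A" "span A = V"
    using assms finite_if_independent_in_fin_dim_subspace span_subspace subspace_if_fin_dim_subspace
    by blast+
  then show thesis
    using A that by blast
qed

lemma fin_dim_subspace_subset:
  assumes "fin_dim_subspace V" "subspace W" "W \<subseteq> V"
  shows "fin_dim_subspace W"
proof -
  obtain A where A: "A \<subseteq> W" "independent A" "W \<subseteq> span A"
    using basis_exists by metis
  then have "finite A"
    using finite_if_independent_in_fin_dim_subspace assms(1,3) by blast
  moreover have "span A = W"
    using A(1,3) assms(2) by (rule span_subspace)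
  ultimately show ?thesis
    using fin_dim_subspace_span by blast
qed

lemma dim_mono_fin_dim_subspace:
  assumes "fin_dim_subspace V" "W \<subseteq> V"
  shows "dim W \<le> dim V"
proof -
  obtain A where "finite A" "span A = V" "card A = dim V"
    using assms(1) by (rule fin_dim_subspace_basis)
  then show ?thesis
    using assms(2) dim_le_card by metis
qed

lemma span_Un_eq_set_plus: "span (S \<union> T) = span S + span T"
  unfolding span_Un set_plus_def by auto

lemma fin_dim_subspace_set_plus:
  assumes "fin_dim_subspace V" "fin_dim_subspace W"
  shows "fin_dim_subspace (V + W)"
  using assms unfolding fin_dim_subspace_def by (metis finite_Un span_Un_eq_set_plus)

lemma set_plus_absorb:
  assumes "subspace V" "0 \<in> W" "W \<subseteq> V"
  shows "V + W = V"
proof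
  show "V + W \<subseteq> V"
    using assms(1,3) subspace_add unfolding set_plus_def by blast
  show "V \<subseteq> V + W"
    using assms(2) set_zero_plus2 by (metis add.commute)
qed

lemma not_in_span_Un_if_disjoint_spans:
  assumes indep: "independent A" and disj: "span A \<inter> span B = {0}" and a: "a \<in> A"
  shows "a \<notin> span ((A \<union> B) - {a})"
proof
  assume "a \<in> span ((A \<union> B) - {a})"
  then have "a \<in> span ((A - {a}) \<union> B)"
    using span_mono[of "(A \<union> B) - {a}" "(A - {a}) \<union> B"] by blast
  then obtain x y where xy: "a = x + y" "x \<in> span (A - {a})" "y \<in> span B"
    unfolding span_Un by blast
  have "x \<in> span A"
    using xy(2) span_mono[of "A - {a}" A] by blast
  moreover have "y = a - x"
    using xy(1) by simp
  ultimately have "y \<in> span A"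
    using a by (simp add: span_base span_diff)
  then have "y = 0"
    using xy(3) disj by blast
  then have "a \<in> span (A - {a})"
    using xy(1,2) by (metis add.right_neutral)
  then show False
    using indep a unfolding dependent_def by blast
qed

lemma independent_Un_if_disjoint_spans:
  assumes "independent A" "independent B" "span A \<inter> span B = {0}"
  shows "independent (A \<union> B)"
  using assms not_in_span_Un_if_disjoint_spans[of A B] not_in_span_Un_if_disjoint_spans[of B A]
  unfolding dependent_def[of "A \<union> B"] by (auto simp: Int_commute Un_commute)

lemma disjoint_spans_if_independent_Un:
  assumes "independent (A \<union> B)" "A \<inter> B = {}"
  shows "span A \<inter> span B = {0}"
proof -
  have "v = 0" if v: "v \<in> span A" "v \<in> span B" for v
  proof -
    have eq: "representation (A \<union> B) v = representation A v"
      "representation (A \<union> B) v = representation B v"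
      using representation_extend[OF assms(1)] v by blast+
    have "representation (A \<union> B) v b = 0" for b
      using eq assms(2) representation_ne_zero[of A v b] representation_ne_zero[of B v b]
      by fastforce
    moreover have "v \<in> span (A \<union> B)"
      using v(1) span_mono by blast
    ultimately show ?thesis
      using sum_nonzero_representation_eq[OF assms(1), of v] by simp
  qed
  then show ?thesis
    using span_zero by blast
qed

lemma fin_dim_subspace_complement:
  assumes V: "fin_dim_subspace V" and W: "subspace W" "W \<subseteq> V"
  obtains D where "fin_dim_subspace D" "W \<inter> D = {0}" "W + D = V"
proof -
  obtain A where A: "A \<subseteq> W" "independent A" "W \<subseteq> span A"
    using basis_exists by metis
  then have "A \<subseteq> V"
    using W(2) by blast
  then obtain C where C: "A \<subseteq> C" "C \<subseteq> V" "independent C" "V \<subseteq> span C"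
    using maximal_independent_subset_extend A(2) by metis
  have span: "span A = W" "span C = V"
    using span_subspace[OF A(1,3) W(1)] span_subspace[OF C(2,4) subspace_if_fin_dim_subspace[OF V]]
    by blast+
  have C_eq: "A \<union> (C - A) = C"
    using C(1) by blast
  have "finite C"
    using V C(3,2) by (rule finite_if_independent_in_fin_dim_subspace)
  then have "fin_dim_subspace (span (C - A))"
    by (simp add: fin_dim_subspace_span)
  moreover have "W \<inter> span (C - A) = {0}"
    using disjoint_spans_if_independent_Un[of A "C - A"] C(3) C_eq span(1) by auto
  moreover have "W + span (C - A) = V"
    using span_Un_eq_set_plus[of A "C - A"] C_eq span by simp
  ultimately show thesis
    using that by blast
qed

lemma dim_set_plus_direct:
  assumes "fin_dim_subspace V" "fin_dim_subspace W" and disj: "V \<inter> W = {0}"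
  shows "dim (V + W) = dim V + dim W"
proof -
  obtain A where A: "finite A" "independent A" "span A = V" "card A = dim V"
    using assms(1) by (rule fin_dim_subspace_basis)
  obtain B where B: "finite B" "independent B" "span B = W" "card B = dim W"
    using assms(2) by (rule fin_dim_subspace_basis)
  have "A \<inter> B \<subseteq> {0}"
    using A(3) B(3) disj span_superset by blast
  then have "A \<inter> B = {}"
    using A(2) dependent_zero by blast
  moreover have "independent (A \<union> B)"
    using A B disj by (simp add: independent_Un_if_disjoint_spans)
  ultimately have "dim (span (A \<union> B)) = card A + card B"
    using A(1) B(1) by (simp add: dim_eq_card_independent card_Un_disjoint)
  then show ?thesis
    using A B by (simp add: span_Un_eq_set_plus)
qed

lemma dim_set_plus_add_dim_Int:
  assumes V: "fin_dim_subspace V" and W: "fin_dim_subspace W"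
  shows "dim (V + W) + dim (V \<inter> W) = dim V + dim W"
proof -
  have subsp: "subspace V" "subspace (V \<inter> W)"
    using V W by (simp_all add: subspace_if_fin_dim_subspace subspace_inter)
  obtain D where D: "fin_dim_subspace D"
    and disj: "V \<inter> W \<inter> D = {0}" and W_eq: "V \<inter> W + D = W"
    using fin_dim_subspace_complement[OF W subsp(2)] by blast
  have "D \<subseteq> W"
    using set_zero_plus2[OF subspace_0[OF subsp(2)]] W_eq by blast
  then have "V \<inter> D = {0}"
    using disj by blast
  moreover have "V + W = V + D"
    using set_plus_absorb[OF subsp(1) subspace_0[OF subsp(2)]] W_eq
    by (metis add.assoc inf.cobounded1)
  ultimately have "dim (V + W) = dim V + dim D"
    using dim_set_plus_direct[OF V D] by simp
  moreover have "dim W = dim (V \<inter> W) + dim D"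
    using dim_set_plus_direct[OF fin_dim_subspace_subset[OF V subsp(2)] D disj] W_eq by simp
  ultimately show ?thesis
    by simp
qed

section \<open>Sums of families of subspaces\<close>

lemma set_sum_eq_span_UN:
  assumes "finite X" "\<And>e. e \<in> X \<Longrightarrow> subspace (U e)"
  shows "(\<Sum>e\<in>X. U e) = span (\<Union>e\<in>X. U e)"
  using assms
proof (induction X rule: finite_induct)
  case empty
  then show ?case by simp
next
  case (insert e X)
  then have "(\<Sum>e\<in>insert e X. U e) = span (U e) + span (\<Union>e\<in>X. U e)"
    by (simp add: span_eq_iff[THEN iffD2])
  then show ?case
    by (simp flip: span_Un_eq_set_plus)
qed

lemma set_sum_mono_family:
  assumes "finite Y" "X \<subseteq> Y" "\<And>e. e \<in> Y \<Longrightarrow> subspace (U e)"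
  shows "(\<Sum>e\<in>X. U e) \<subseteq> (\<Sum>e\<in>Y. U e)"
proof -
  have "span (\<Union>e\<in>X. U e) \<subseteq> span (\<Union>e\<in>Y. U e)"
    using assms(2) by (intro span_mono) blast
  then show ?thesis
    using assms by (simp add: set_sum_eq_span_UN finite_subset subset_iff)
qed

lemma set_sum_Un:
  assumes "finite X" "finite Y" "\<And>e. e \<in> X \<union> Y \<Longrightarrow> subspace (U e)"
  shows "(\<Sum>e\<in>X \<union> Y. U e) = (\<Sum>e\<in>X. U e) + (\<Sum>e\<in>Y. U e)"
proof -
  have "(\<Sum>e\<in>X \<union> Y. U e) = span (\<Union>e\<in>X \<union> Y. U e)"
    using assms by (intro set_sum_eq_span_UN) auto
  then show ?thesis
    using assms by (simp add: set_sum_eq_span_UN UN_Un span_Un_eq_set_plus)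
qed

lemma fin_dim_subspace_set_sum:
  assumes "finite X" "\<And>e. e \<in> X \<Longrightarrow> fin_dim_subspace (U e)"
  shows "fin_dim_subspace (\<Sum>e\<in>X. U e)"
  using assms
proof (induction X rule: finite_induct)
  case empty
  then show ?case
    using fin_dim_subspace_span[of "{}"] by simp
next
  case (insert e X)
  then show ?case
    by (simp add: fin_dim_subspace_set_plus)
qed

lemma set_sum_Int_subset:
  assumes "finite X" "\<And>e. e \<in> X \<Longrightarrow> subspace (U e)" and W: "subspace W"
  shows "(\<Sum>e\<in>X. U e \<inter> W) \<subseteq> (\<Sum>e\<in>X. U e) \<inter> W"
proof -
  have "span (\<Union>e\<in>X. U e \<inter> W) \<subseteq> span (\<Union>e\<in>X. U e)"
    by (intro span_mono) blast
  moreover have "span (\<Union>e\<in>X. U e \<inter> W) \<subseteq> W"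
    using W by (intro span_minimal) blast
  ultimately show ?thesis
    using assms by (simp add: set_sum_eq_span_UN subspace_inter)
qed

end

section \<open>Local connectivity\<close>

definition local_connectivity :: "('e set \<Rightarrow> real) \<Rightarrow> 'e set \<Rightarrow> 'e set \<Rightarrow> real" where
  "local_connectivity f X Y = f X + f Y - f (X \<union> Y)"

lemma local_connectivity_self: "local_connectivity f X X = f X"
  unfolding local_connectivity_def by simp

lemma extends_matroid_iff_local_connectivity:
  "extends_matroid E r B g \<longleftrightarrow>
    (\<forall>C S. C \<subseteq> B \<and> S \<subseteq> E \<longrightarrow>
      local_connectivity g C S = local_connectivity (\<lambda>X. real (r X)) C S)"
  unfolding extends_matroid_def local_connectivity_def by (simp add: Un_commute)

lemma (in general_vector_space) dim_set_sum_Int_eq_local_connectivity: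
  assumes "finite X" "finite Y" "\<And>e. e \<in> X \<union> Y \<Longrightarrow> fin_dim_subspace (U e)"
  shows "real (dim ((\<Sum>e\<in>X. U e) \<inter> (\<Sum>e\<in>Y. U e))) =
    local_connectivity (\<lambda>Z. real (dim (\<Sum>e\<in>Z. U e))) X Y"
proof -
  have "dim ((\<Sum>e\<in>X. U e) + (\<Sum>e\<in>Y. U e)) + dim ((\<Sum>e\<in>X. U e) \<inter> (\<Sum>e\<in>Y. U e)) =
      dim (\<Sum>e\<in>X. U e) + dim (\<Sum>e\<in>Y. U e)"
    using assms by (intro dim_set_plus_add_dim_Int fin_dim_subspace_set_sum) auto
  moreover have "(\<Sum>e\<in>X \<union> Y. U e) = (\<Sum>e\<in>X. U e) + (\<Sum>e\<in>Y. U e)"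
    using assms by (intro set_sum_Un subspace_if_fin_dim_subspace)
  ultimately show ?thesis
    unfolding local_connectivity_def by (simp flip: of_nat_add)
qed

section \<open>Matroids\<close>

lemma finite_subset_matroid: "matroid E r \<Longrightarrow> X \<subseteq> E \<Longrightarrow> finite X"
  unfolding matroid_def by (auto intro: finite_subset)

lemma rank_le_card: "matroid E r \<Longrightarrow> X \<subseteq> E \<Longrightarrow> r X \<le> card X"
  unfolding matroid_def by simp

lemma rank_mono: "matroid E r \<Longrightarrow> X \<subseteq> Y \<Longrightarrow> Y \<subseteq> E \<Longrightarrow> r X \<le> r Y"
  unfolding matroid_def by simp

lemma rank_submodular:
  "matroid E r \<Longrightarrow> X \<subseteq> E \<Longrightarrow> Y \<subseteq> E \<Longrightarrow> r (X \<union> Y) + r (X \<inter> Y) \<le> r X + r Y"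
  unfolding matroid_def by simp

lemma rank_Un_eq_if_rank_insert_eq:
  assumes M: "matroid E r" and sub: "B \<subseteq> E" "S \<subseteq> E"
    and insert_eq: "\<And>e. e \<in> S \<Longrightarrow> r (insert e B) = r B"
  shows "r (S \<union> B) = r B"
proof -
  have "finite S"
    using M sub(2) by (rule finite_subset_matroid)
  then have "r (S \<union> B) \<le> r B"
    using sub(2) insert_eq
  proof (induction S rule: finite_induct)
    case empty
    then show ?case by simp
  next
    case (insert e S)
    have in_E: "S \<union> B \<subseteq> E" "insert e B \<subseteq> E"
      using insert.prems(1) sub(1) by auto
    have "r B \<le> r ((S \<union> B) \<inter> insert e B)"
      by (rule rank_mono[OF M]) (use in_E in auto)
    moreover have "r (S \<union> B) \<le> r B" "r (insert e B) = r B"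
      using insert by auto
    moreover have "(S \<union> B) \<union> insert e B = insert e S \<union> B"
      by blast
    ultimately show ?case
      using rank_submodular[OF M in_E] by simp
  qed
  moreover have "r B \<le> r (S \<union> B)"
    using rank_mono[OF M] sub by simp
  ultimately show ?thesis by simp
qed

lemma rank_insert_basis:
  assumes M: "matroid E r" and B: "basis E r B" and e: "e \<in> E"
  shows "r (insert e B) = r B"
proof (cases "e \<in> B")
  case True
  then show ?thesis by (simp add: insert_absorb)
next
  case False
  have sub: "insert e B \<subseteq> E" and card: "r B = card B"
    and "\<And>I. I \<subseteq> E \<Longrightarrow> r I = card I \<Longrightarrow> B \<subseteq> I \<Longrightarrow> I = B"
    using B e unfolding basis_def indep_def by auto
  then have max: "r (insert e B) \<noteq> card (insert e B)"
    using False by blast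
  have "finite B"
    using finite_subset_matroid[OF M sub] by simp
  moreover have "r (insert e B) \<le> card (insert e B)"
    using M sub by (rule rank_le_card)
  moreover have "r B \<le> r (insert e B)"
    using rank_mono[OF M _ sub] by blast
  ultimately show ?thesis
    using False card max by simp
qed

lemma rank_Un_basis:
  assumes "matroid E r" "basis E r B" "S \<subseteq> E"
  shows "r (S \<union> B) = r B"
proof (rule rank_Un_eq_if_rank_insert_eq[OF assms(1) _ assms(3)])
  show "B \<subseteq> E"
    using assms(2) unfolding basis_def indep_def by blast
  show "r (insert e B) = r B" if "e \<in> S" for e
    using assms that by (blast intro: rank_insert_basis)
qed

lemma rank_singleton_if_loopless:
  assumes "matroid E r" "loopless E r" "e \<in> E"
  shows "r {e} = 1"
proof -
  have "r {e} \<le> card {e}"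
    using assms(1,3) by (intro rank_le_card) auto
  then show ?thesis
    using assms(2,3) unfolding loopless_def by (simp add: le_Suc_eq)
qed

section \<open>Subspace arrangements and matroid extensions\<close>

context general_vector_space
begin

lemma subspace_arrangement_iff:
  "subspace_arrangement scale E U \<longleftrightarrow> (\<forall>e\<in>E. fin_dim_subspace (U e))"
  unfolding subspace_arrangement_def fin_dim_subspace_def by (metis subspace_span)

lemma weak_representation_iff_dim:
  assumes "c \<ge> 1"
  shows "weak_representation scale c E r B A \<longleftrightarrow>
    (\<forall>e\<in>E. fin_dim_subspace (A e) \<and> dim (A e) = c) \<and>
    (\<forall>X\<subseteq>E. dim (\<Sum>e\<in>X. A e) \<le> c * r X) \<and>
    (\<forall>Y\<subseteq>E. card (Y - B) \<le> 1 \<longrightarrow> dim (\<Sum>e\<in>Y. A e) = c * r Y)"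
proof -
  have rank: "arrangement_rank scale c A X = real (dim (\<Sum>e\<in>X. A e)) / real c" for X
    unfolding arrangement_rank_def by simp
  have "arrangement_rank scale c A X \<le> real (r X) \<longleftrightarrow> dim (\<Sum>e\<in>X. A e) \<le> c * r X"
    "arrangement_rank scale c A X = real (r X) \<longleftrightarrow> dim (\<Sum>e\<in>X. A e) = c * r X" for X
    unfolding rank using assms
    by (simp_all add: pos_divide_le_eq divide_eq_eq mult.commute flip: of_nat_mult)
  then show ?thesis
    unfolding weak_representation_def subspace_arrangement_iff by auto
qed

end

locale matroid_extension_arrangement = general_vector_space scale
  for scale :: "'k::field \<Rightarrow> 'v::ab_group_add \<Rightarrow> 'v" +
  fixes E B :: "'e set" and r :: "'e set \<Rightarrow> nat" and g :: "'e set \<Rightarrow> real"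
    and U :: "'e \<Rightarrow> 'v set" and c :: nat
  assumes matroid: "matroid E r" and basis: "basis E r B"
    and extends: "extends_matroid E r B g"
    and arrangement: "subspace_arrangement scale E U"
    and dim_sum: "\<And>T. T \<subseteq> E \<Longrightarrow> real (dim (\<Sum>e\<in>T. U e)) = real c * g T"
begin

definition U_sum :: "'e set \<Rightarrow> 'v set" where
  "U_sum X = (\<Sum>e\<in>X. U e)"

lemma basis_subset: "B \<subseteq> E"
  using basis unfolding basis_def indep_def by simp

lemma finite_subset_ground: "X \<subseteq> E \<Longrightarrow> finite X"
  using matroid by (rule finite_subset_matroid)

lemma fin_dim_subspace_U: "e \<in> E \<Longrightarrow> fin_dim_subspace (U e)"
  using arrangement subspace_arrangement_iff by blast

lemma subspace_U: "e \<in> E \<Longrightarrow> subspace (U e)"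
  by (simp add: fin_dim_subspace_U subspace_if_fin_dim_subspace)

lemma fin_dim_subspace_U_sum: "X \<subseteq> E \<Longrightarrow> fin_dim_subspace (U_sum X)"
  unfolding U_sum_def
  using finite_subset_ground fin_dim_subspace_U by (blast intro: fin_dim_subspace_set_sum)

lemma subspace_U_sum: "X \<subseteq> E \<Longrightarrow> subspace (U_sum X)"
  by (simp add: fin_dim_subspace_U_sum subspace_if_fin_dim_subspace)

lemma U_sum_mono: "X \<subseteq> Y \<Longrightarrow> Y \<subseteq> E \<Longrightarrow> U_sum X \<subseteq> U_sum Y"
  unfolding U_sum_def by (intro set_sum_mono_family finite_subset_ground subspace_U) auto

lemma fin_dim_subspace_Int_U_sum:
  assumes "X \<subseteq> E" "Y \<subseteq> E"
  shows "fin_dim_subspace (U_sum X \<inter> U_sum Y)"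
  by (rule fin_dim_subspace_subset[OF fin_dim_subspace_U_sum[OF assms(1)]])
    (simp_all add: assms subspace_inter subspace_U_sum)

lemma dim_U_sum_Int:
  assumes "C \<subseteq> B" "S \<subseteq> E"
  shows "real (dim (U_sum C \<inter> U_sum S)) =
    real c * local_connectivity (\<lambda>X. real (r X)) C S"
proof -
  have CE: "C \<subseteq> E"
    using assms(1) basis_subset by blast
  have "real (dim (U_sum C \<inter> U_sum S)) =
      local_connectivity (\<lambda>X. real (dim (\<Sum>e\<in>X. U e))) C S"
    unfolding U_sum_def using CE assms(2)
    by (intro dim_set_sum_Int_eq_local_connectivity finite_subset_ground fin_dim_subspace_U) auto
  also have "\<dots> = real c * local_connectivity g C S"
    unfolding local_connectivity_def using CE assms(2) by (simp add: dim_sum algebra_simps)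
  also have "local_connectivity g C S = local_connectivity (\<lambda>X. real (r X)) C S"
    using extends assms unfolding extends_matroid_iff_local_connectivity by blast
  finally show ?thesis .
qed

lemma dim_U_sum_basis_subset:
  assumes "C \<subseteq> B"
  shows "dim (U_sum C) = c * r C"
proof -
  have "real (dim (U_sum C)) = real (c * r C)"
    using dim_U_sum_Int[OF assms, of C] assms basis_subset
    by (simp add: local_connectivity_self)
  then show ?thesis
    by (simp only: of_nat_eq_iff)
qed

lemma dim_U_sum_Int_basis:
  assumes "S \<subseteq> E"
  shows "dim (U_sum S \<inter> U_sum B) = c * r S"
proof -
  have "r (B \<union> S) = r B"
    using rank_Un_basis[OF matroid basis assms] by (simp add: Un_commute)
  then have "real (dim (U_sum S \<inter> U_sum B)) = real (c * r S)"
    using dim_U_sum_Int[OF order_refl assms] by (simp add: local_connectivity_def Int_commute)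
  then show ?thesis
    by (simp only: of_nat_eq_iff)
qed

lemma dim_U_sum_plus_Int_basis:
  assumes "C \<subseteq> B" "S \<subseteq> E"
  shows "dim (U_sum C + U_sum S \<inter> U_sum B) = c * r (C \<union> S)"
proof -
  have "U_sum C \<inter> (U_sum S \<inter> U_sum B) = U_sum C \<inter> U_sum S"
    using U_sum_mono[OF assms(1) basis_subset] by blast
  then have "dim (U_sum C + U_sum S \<inter> U_sum B) + dim (U_sum C \<inter> U_sum S) = c * r C + c * r S"
    using dim_set_plus_add_dim_Int[of "U_sum C" "U_sum S \<inter> U_sum B"] assms basis_subset
    by (simp add: fin_dim_subspace_U_sum fin_dim_subspace_Int_U_sum
        dim_U_sum_basis_subset dim_U_sum_Int_basis)
  then have "real (dim (U_sum C + U_sum S \<inter> U_sum B)) + real (dim (U_sum C \<inter> U_sum S)) =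
      real c * real (r C) + real c * real (r S)"
    by (simp flip: of_nat_add of_nat_mult)
  then have "real (dim (U_sum C + U_sum S \<inter> U_sum B)) = real (c * r (C \<union> S))"
    unfolding dim_U_sum_Int[OF assms] local_connectivity_def by (simp add: algebra_simps)
  then show ?thesis
    by (simp only: of_nat_eq_iff)
qed

definition trace :: "'e \<Rightarrow> 'v set" where
  "trace e = U e \<inter> U_sum B"

lemma trace_eq_U_sum_singleton_Int: "trace e = U_sum {e} \<inter> U_sum B"
  unfolding trace_def U_sum_def by simp

lemma fin_dim_subspace_trace: "e \<in> E \<Longrightarrow> fin_dim_subspace (trace e)"
  unfolding trace_eq_U_sum_singleton_Int
  by (simp add: basis_subset fin_dim_subspace_Int_U_sum)

lemma dim_trace: "e \<in> E \<Longrightarrow> dim (trace e) = c * r {e}"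
  unfolding trace_eq_U_sum_singleton_Int by (simp add: dim_U_sum_Int_basis)

lemma dim_sum_trace_le:
  assumes "X \<subseteq> E"
  shows "dim (\<Sum>e\<in>X. trace e) \<le> c * r X"
proof -
  have "(\<Sum>e\<in>X. trace e) \<subseteq> U_sum X \<inter> U_sum B"
    unfolding trace_def U_sum_def[of X] using assms
    by (intro set_sum_Int_subset finite_subset_ground subspace_U subspace_U_sum basis_subset) auto
  then have "dim (\<Sum>e\<in>X. trace e) \<le> dim (U_sum X \<inter> U_sum B)"
    by (rule dim_mono_fin_dim_subspace[OF fin_dim_subspace_Int_U_sum[OF assms basis_subset]])
  then show ?thesis
    using assms by (simp add: dim_U_sum_Int_basis)
qed

lemma sum_trace_basis_subset:
  assumes "C \<subseteq> B"
  shows "(\<Sum>e\<in>C. trace e) = U_sum C"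
proof -
  have "trace e = U e" if "e \<in> C" for e
    using U_sum_mono[of "{e}" B] that assms basis_subset unfolding trace_def
    by (auto simp: U_sum_def[of "{e}"])
  then show ?thesis
    unfolding U_sum_def by simp
qed

lemma sum_trace_card_le_1:
  assumes "finite S" "card S \<le> 1"
  shows "(\<Sum>e\<in>S. trace e) = U_sum S \<inter> U_sum B"
proof (cases "S = {}")
  case True
  then show ?thesis
    using subspace_0[OF subspace_U_sum[OF basis_subset]] by (simp add: U_sum_def[of "{}"])
next
  case False
  then obtain e where "S = {e}"
    using assms by (metis card_0_eq card_1_singletonE le_antisym less_one not_le)
  then show ?thesis
    by (simp add: trace_eq_U_sum_singleton_Int)
qed

lemma dim_sum_trace_eq:
  assumes "Y \<subseteq> E" "card (Y - B) \<le> 1"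
  shows "dim (\<Sum>e\<in>Y. trace e) = c * r Y"
proof -
  have fin: "finite (Y \<inter> B)" "finite (Y - B)"
    using finite_subset_ground[OF assms(1)] by auto
  have "(\<Sum>e\<in>Y. trace e) = (\<Sum>e\<in>Y \<inter> B. trace e) + (\<Sum>e\<in>Y - B. trace e)"
    using finite_subset_ground[OF assms(1)] by (rule sum.Int_Diff)
  also have "\<dots> = U_sum (Y \<inter> B) + U_sum (Y - B) \<inter> U_sum B"
    using fin assms(2) by (simp add: sum_trace_basis_subset sum_trace_card_le_1)
  finally have "dim (\<Sum>e\<in>Y. trace e) = c * r (Y \<inter> B \<union> (Y - B))"
    using dim_U_sum_plus_Int_basis[of "Y \<inter> B" "Y - B"] assms(1) by auto
  then show ?thesis
    by (simp add: Int_Diff_Un)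
qed

end

theorem theorem7p1:
  fixes scale :: "'k::field \<Rightarrow> 'v::ab_group_add \<Rightarrow> 'v"
    and E B :: "'e set" and r :: "'e set \<Rightarrow> nat" and g :: "'e set \<Rightarrow> real"
    and U :: "'e \<Rightarrow> 'v set" and c :: nat
  assumes "vector_space scale"
    and "matroid E r" and "loopless E r" and "r E = 3" and "basis E r B"
    and "polymatroid E g" and "extends_matroid E r B g"
    and "c \<ge> 1"
    and "subspace_arrangement scale E U"
    and "\<And>T. T \<subseteq> E \<Longrightarrow> real (vector_space.dim scale (\<Sum>e\<in>T. U e)) = real c * g T"
  shows "weak_representation scale c E r B (\<lambda>e. U e \<inter> (\<Sum>b\<in>B. U b))"
proof -
  interpret matroid_extension_arrangement scale E B r g U c
    using assms
    by (intro matroid_extension_arrangement.intro general_vector_space.intro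
        matroid_extension_arrangement_axioms.intro)
  have "dim (trace e) = c" if "e \<in> E" for e
    using dim_trace[OF that] rank_singleton_if_loopless[OF assms(2,3) that] by simp
  then have "weak_representation scale c E r B trace"
    using fin_dim_subspace_trace dim_sum_trace_le dim_sum_trace_eq
    by (simp add: weak_representation_iff_dim[OF assms(8)])
  then show ?thesis
    unfolding trace_def U_sum_def .
qed

end
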